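(* Let the thermodynamic entropy of an ideal $N$-particle gas ($N\ge1$) at temperature $T$ in volume $V$ be $$S(T,V,N)=S^{\rm C}(T,V,N)+k_{\rm B}f^{\rm C}(N),$$ where $S^{\rm C}(T,V,N)=\tfrac32Nk_{\rm B}[\ln(2\pi mk_{\rm B}T)+1]+Nk_{\rm B}\ln V-3Nk_{\rm B}\ln\xi$ is the classical statistical-mechanical entropy and $f^{\rm C}$ is a real-valued function of the particle number. Assume that the thermodynamic entropy is additive, and that for all integers $N,M\ge1$ the entropy production $\Delta S$ of the mixing of an $N$-particle gas and an $M$-particle gas of the same kind, initially in two equal halves of volume $V$ at the same temperature, satisfies $\Delta S=-k_{\rm B}\ln(1-\lambda_{\rm S})$, where $\lambda_{\rm S}$ is the singular probability of the mixing process. Then, for every integer $N\ge1$, $$f^{\rm C}(N)=Nf^{\rm C}(1)-\ln N!.$$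
   Context: Here $m>0$ is the particle mass, $\xi>0$ a constant with the dimension of action, and $k_{\rm B}>0$ the Boltzmann constant. Mixing process: a box of volume $2V$ is divided by a partition into equal halves containing, respectively, $N$ and $M$ ideal-gas particles of the same kind at temperature $T$; the partition is removed and the gases expand to the entire box, giving an $(N+M)$-particle gas in volume $2V$ at temperature $T$. By additivity, the initial entropy is $S(T,V,N)+S(T,V,M)$, so $\Delta S=S(T,2V,N+M)-S(T,V,N)-S(T,V,M)$. Singular probability: in the reverse process the partition is reinserted in the middle of the box containing the $(N+M)$-particle gas at equilibrium, so that each particle is independently in the left half with probability $1/2$; $\lambda_{\rm S}$ is the probability that the number of particles in the left half is different from $N$, i.e. $\lambda_{\rm S}=1-\binom{N+M}{N}2^{-(N+M)}$. *)

theory Defs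
  imports "HOL-Probability.Probability"
begin

text \<open>
  \<^term>\<open>Gas T V N\<close> is an ideal \<open>N\<close>-particle gas in equilibrium at temperature \<open>T\<close> in volume \<open>V\<close>;
  \<^term>\<open>Partitioned A B\<close> is the composite system whose subsystems \<open>A\<close> and \<open>B\<close> are separated by a
  partition. All gases occurring in a system are of the same kind.
\<close>

datatype gas_system =
    Gas real real nat
  | Partitioned gas_system gas_system

primrec physical :: "gas_system \<Rightarrow> bool" where
  "physical (Gas T V N) \<longleftrightarrow> T > 0 \<and> V > 0 \<and> N \<ge> 1"
| "physical (Partitioned A B) \<longleftrightarrow> physical A \<and> physical B"

definition additive_entropy :: "(gas_system \<Rightarrow> real) \<Rightarrow> bool" where
  "additive_entropy S \<longleftrightarrow>
     (\<forall>A B. physical A \<longrightarrow> physical B \<longrightarrow> S (Partitioned A B) = S A + S B)"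

text \<open>Arguments: particle mass, action constant, Boltzmann constant, then \<open>T\<close>, \<open>V\<close>, \<open>N\<close>.\<close>

definition classical_entropy ::
    "real \<Rightarrow> real \<Rightarrow> real \<Rightarrow> real \<Rightarrow> real \<Rightarrow> nat \<Rightarrow> real" where
  "classical_entropy m \<xi> k\<^sub>B T V N =
     3 / 2 * real N * k\<^sub>B * (ln (2 * pi * m * k\<^sub>B * T) + 1)
     + real N * k\<^sub>B * ln V - 3 * real N * k\<^sub>B * ln \<xi>"

definition mixing_entropy_production ::
    "(gas_system \<Rightarrow> real) \<Rightarrow> real \<Rightarrow> real \<Rightarrow> nat \<Rightarrow> nat \<Rightarrow> real" where
  "mixing_entropy_production S T V N M =
     S (Gas T (2 * V) (N + M)) - S (Partitioned (Gas T V N) (Gas T V M))"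

text \<open>
  Particles are labelled by \<open>i < N + M\<close>, and \<open>\<omega> i\<close> says that particle \<open>i\<close> is in the left half
  when the partition is reinserted; \<open>False\<close> is the dummy value of \<open>\<omega>\<close> outside the label set.
\<close>

definition singular_probability :: "nat \<Rightarrow> nat \<Rightarrow> real" where
  "singular_probability N M =
     measure_pmf.prob (Pi_pmf {..<N + M} False (\<lambda>_. bernoulli_pmf (1 / 2)))
       {\<omega>. card {i \<in> {..<N + M}. \<omega> i} \<noteq> N}"

lemma singular_probability_eq:
  "singular_probability N M = 1 - real ((N + M) choose N) / 2 ^ (N + M)"
proof -
  let ?P = "Pi_pmf {..<N + M} False (\<lambda>_. bernoulli_pmf (1 / 2))"
  let ?c = "\<lambda>\<omega>. card {i \<in> {..<N + M}. \<omega> i}"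
  have bin: "binomial_pmf (N + M) (1 / 2) = map_pmf ?c ?P"
    by (rule binomial_pmf_altdef') auto
  have "singular_probability N M = measure_pmf.prob (binomial_pmf (N + M) (1 / 2)) (- {N})"
    unfolding singular_probability_def bin by (simp add: vimage_def)
  also have "\<dots> = 1 - pmf (binomial_pmf (N + M) (1 / 2)) N"
    using measure_pmf.prob_compl[of "{N}" "binomial_pmf (N + M) (1 / 2)"]
    by (simp add: Compl_eq_Diff_UNIV measure_pmf_single)
  also have "\<dots> = 1 - real ((N + M) choose N) / 2 ^ (N + M)"
    by (simp add: power_add power_one_over field_simps)
  finally show ?thesis .
qed

end

(* Doubling the volume contributes (N + M) ln 2 to the mixing balance, which cancels the
   factor 2^(N + M) of the singular probability; what remains is
   f(N + M) = f(N) + f(M) - ln ((N + M) choose N). The case M = 1 is a recursion solved by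
   f(N) = N f(1) - ln N!. *)

theory Submission
  imports Defs
begin

text \<open>At fixed temperature and volume the classical entropy is linear in the particle number,
  so merging the gases changes nothing by itself; each particle gains
  \<open>k\<^sub>B * ln 2\<close> from the doubled volume.\<close>

lemma classical_entropy_double_volume:
  assumes "V > 0"
  shows "classical_entropy m \<xi> k\<^sub>B T (2 * V) (N + M)
           = classical_entropy m \<xi> k\<^sub>B T V N + classical_entropy m \<xi> k\<^sub>B T V M
             + real (N + M) * k\<^sub>B * ln 2"
proof -
  have "ln (2 * V) = ln 2 + ln V"
    using assms by (simp add: ln_mult)
  then show ?thesis
    unfolding classical_entropy_def of_nat_add by algebra
qed

lemma ln_one_minus_singular_probability:
  "ln (1 - singular_probability N M) = ln (real ((N + M) choose N)) - real (N + M) * ln 2"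
  by (simp add: singular_probability_eq ln_div ln_realpow)

text \<open>Each step adds the constant \<open>f 1\<close> and one logarithm; the logarithms
  accumulate to that of the factorial, and \<open>f 1\<close> stays a free parameter.\<close>

lemma log_factorial_recursion:
  fixes f :: "nat \<Rightarrow> real"
  assumes step: "\<And>n. n \<ge> 1 \<Longrightarrow> f (n + 1) = f n + f 1 - ln (real (n + 1))"
    and "N \<ge> 1"
  shows "f N = real N * f 1 - ln (fact N)"
  using \<open>N \<ge> 1\<close>
proof (induction N rule: dec_induct)
  case base
  show ?case by simp
next
  case (step n)
  have "ln (fact (Suc n) :: real) = ln (real (n + 1)) + ln (fact n)"
    by (simp add: ln_mult add.commute)
  with step assms(1)[of n] show ?case
    by (simp add: algebra_simps)
qed

theorem mainTheorem7:
  fixes m \<xi> k\<^sub>B :: real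
    and S :: "gas_system \<Rightarrow> real"
    and f\<^sub>C :: "nat \<Rightarrow> real"
  assumes "m > 0" and "\<xi> > 0" and "k\<^sub>B > 0"
    and "\<forall>T V N. T > 0 \<longrightarrow> V > 0 \<longrightarrow> N \<ge> 1 \<longrightarrow>
           S (Gas T V N) = classical_entropy m \<xi> k\<^sub>B T V N + k\<^sub>B * f\<^sub>C N"
    and "additive_entropy S"
    and "\<forall>T V N M. T > 0 \<longrightarrow> V > 0 \<longrightarrow> N \<ge> 1 \<longrightarrow> M \<ge> 1 \<longrightarrow>
           mixing_entropy_production S T V N M = - k\<^sub>B * ln (1 - singular_probability N M)"
  shows "\<forall>N\<ge>1. f\<^sub>C N = real N * f\<^sub>C 1 - ln (fact N)"
proof (intro allI impI)
  have mixing: "f\<^sub>C (N + M) = f\<^sub>C N + f\<^sub>C M - ln (real ((N + M) choose N))"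
    if "N \<ge> 1" "M \<ge> 1" for N M
  proof -
    \<comment> \<open>Since \<open>f\<^sub>C\<close> depends on the particle number alone, any
      positive \<open>T\<close> and \<open>V\<close> give the same relation; both are set to 1. The
      bounds on \<open>N\<close> and \<open>M\<close> make the two gases \<open>physical\<close>, as
      additivity demands.\<close>
    have part: "S (Partitioned (Gas 1 1 N) (Gas 1 1 M)) = S (Gas 1 1 N) + S (Gas 1 1 M)"
      using assms(5) that by (simp add: additive_entropy_def)
    have gas: "S (Gas 1 V K) = classical_entropy m \<xi> k\<^sub>B 1 V K + k\<^sub>B * f\<^sub>C K"
      if "V > 0" "K \<ge> 1" for V K
      using assms(4) that by simp
    have "S (Gas 1 (2 * 1) (N + M)) - (S (Gas 1 1 N) + S (Gas 1 1 M))
            = - k\<^sub>B * ln (1 - singular_probability N M)"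
      using assms(6)[rule_format, of 1 1 N M] that
      by (simp add: mixing_entropy_production_def part)
    moreover have "S (Gas 1 (2 * 1) (N + M)) - (S (Gas 1 1 N) + S (Gas 1 1 M))
            = k\<^sub>B * (real (N + M) * ln 2 + f\<^sub>C (N + M) - f\<^sub>C N - f\<^sub>C M)"
      using gas[of "2 * 1" "N + M"] gas[of 1 N] gas[of 1 M] that
        classical_entropy_double_volume[of 1 m \<xi> k\<^sub>B 1 N M]
      by (simp add: algebra_simps)
    ultimately have "k\<^sub>B * (real (N + M) * ln 2 + f\<^sub>C (N + M) - f\<^sub>C N - f\<^sub>C M)
            = k\<^sub>B * (real (N + M) * ln 2 - ln (real ((N + M) choose N)))"
      unfolding ln_one_minus_singular_probability by (simp add: algebra_simps)
    \<comment> \<open>Dividing by the nonzero \<open>k\<^sub>B\<close> leaves the same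
      \<open>ln 2\<close> term on both sides.\<close>
    then show ?thesis
      using \<open>k\<^sub>B > 0\<close> by simp
  qed
  fix N :: nat
  assume "N \<ge> 1"
  show "f\<^sub>C N = real N * f\<^sub>C 1 - ln (fact N)"
  proof (rule log_factorial_recursion[OF _ \<open>N \<ge> 1\<close>])
    fix n :: nat
    assume "n \<ge> 1"
    then show "f\<^sub>C (n + 1) = f\<^sub>C n + f\<^sub>C 1 - ln (real (n + 1))"
      \<comment> \<open>Here \<open>(n + 1) choose n\<close> equals \<open>n + 1\<close>.\<close>
      using mixing[of n 1] by simp
  qed
qed

end
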